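(* Let $F$ be a field, let $D$ be a division algebra with center $F$ and degree $d>2$, let $K|F$ be any splitting field of $D$, and regard $D$ as an $F$-subalgebra of $M_d(K)$ via a splitting representation, so that $D^\times\le \mathrm{GL}_d(K)$. Let $N\le \mathrm{GL}_d(K)$ be the subgroup of monomial matrices and $T\le N$ the subgroup of invertible diagonal matrices. Then there exists a coset $X\in N/T$ such that for every $g\in\mathrm{GL}_d(K)$ we have $gD^\times g^{-1}\cap X=\emptyset$.
   Context: A division algebra $D$ with center $F$ has degree $d$ if $\dim_F(D)=d^2$ (in particular it is finite-dimensional over $F$). A splitting field of $D$ is a field extension $K|F$ with $D\otimes_F K\cong M_d(K)$ as $K$-algebras; a splitting representation is the resulting injective $F$-algebra homomorphism $D\hookrightarrow D\otimes_F K\cong M_d(K)$, by means of which $D$ is identified with its image. $D^\times$ is the multiplicative group of nonzero elements of $D$. A monomial matrix is one with exactly one nonzero entry in each row and each column. Elements of $N/T$ are viewed as subsets (cosets) of $N$. *)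

theory Defs
  imports
    "Jordan_Normal_Form.Matrix"
    "HOL-Algebra.QuotRing"
    "HOL-Algebra.Generated_Groups"
    "HOL-Library.Poly_Mapping"
begin

text \<open>
  An algebra \<open>D\<close> over \<open>F\<close> and a field extension \<open>K|F\<close> are given by their structure maps
  \<open>\<iota> : F \<rightarrow> D\<close> (with central image) and \<open>j : F \<rightarrow> K\<close>.
\<close>

subsection \<open>Central division algebras\<close>

definition center :: "'d::ring_1 set" where
  "center = {z. \<forall>x. z * x = x * z}"

text \<open>
  The library function \<open>dim\<close> is \<open>0\<close> on infinite-dimensional spaces, so \<open>0 < d\<close> makes the
  last conjunct include finite-dimensionality.
\<close>

definition central_division_algebra ::
    "('f::field \<Rightarrow> 'd::division_ring) \<Rightarrow> nat \<Rightarrow> bool" where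
  "central_division_algebra \<iota> d \<longleftrightarrow>
     Ring_Hom.ring_hom \<iota> \<and> range \<iota> = center \<and>
     0 < d \<and> Vector_Spaces.vector_space.dim (\<lambda>c x. \<iota> c * x) (UNIV :: 'd set) = d ^ 2"


subsection \<open>The tensor product of a central algebra with a field extension\<close>

text \<open>
  The free abelian group on \<open>D \<times> K\<close>, with the biadditive multiplication determined by
  \<open>(x, a) (y, b) = (x y, a b)\<close>.
\<close>

definition free_ring :: "('d::ring_1 \<times> 'k::comm_ring_1 \<Rightarrow>\<^sub>0 int) ring" where
  "free_ring = \<lparr>carrier = UNIV,
     mult = (\<lambda>p q. frag_extend (\<lambda>(x, a). frag_extend (\<lambda>(y, b). frag_of (x * y, a * b)) q) p),
     one = frag_of (1, 1), zero = 0, add = (+)\<rparr>"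

definition tensor_relators ::
    "('f::field \<Rightarrow> 'd::ring_1) \<Rightarrow> ('f \<Rightarrow> 'k::comm_ring_1) \<Rightarrow> ('d \<times> 'k \<Rightarrow>\<^sub>0 int) set" where
  "tensor_relators \<iota> j =
     {frag_of (x + y, a) - frag_of (x, a) - frag_of (y, a) | x y a. True} \<union>
     {frag_of (x, a + b) - frag_of (x, a) - frag_of (x, b) | x a b. True} \<union>
     {frag_of (x * \<iota> c, a) - frag_of (x, j c * a) | x c a. True}"

text \<open>
  Only the subgroup generated by the relators is divided out; it is a two-sided ideal, see
  \<open>tensor_kernel_ideal\<close> below.
\<close>

definition tensor_kernel ::
    "('f::field \<Rightarrow> 'd::ring_1) \<Rightarrow> ('f \<Rightarrow> 'k::comm_ring_1) \<Rightarrow> ('d \<times> 'k \<Rightarrow>\<^sub>0 int) set" where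
  "tensor_kernel \<iota> j = generate (add_monoid free_ring) (tensor_relators \<iota> j)"

definition pure_tensor ::
    "('f::field \<Rightarrow> 'd::ring_1) \<Rightarrow> ('f \<Rightarrow> 'k::comm_ring_1) \<Rightarrow> 'd \<Rightarrow> 'k \<Rightarrow> ('d \<times> 'k \<Rightarrow>\<^sub>0 int) set" where
  "pure_tensor \<iota> j x a = tensor_kernel \<iota> j +>\<^bsub>free_ring\<^esub> frag_of (x, a)"

text \<open>The \<open>K\<close>-algebra \<open>D \<otimes>\<^sub>F K\<close>; a scalar \<open>c\<close> acts as multiplication by \<open>1 \<otimes> c\<close>.\<close>

definition tensor_algebra ::
    "('f::field \<Rightarrow> 'd::ring_1) \<Rightarrow> ('f \<Rightarrow> 'k::comm_ring_1) \<Rightarrow> ('k, ('d \<times> 'k \<Rightarrow>\<^sub>0 int) set) module" where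
  "tensor_algebra \<iota> j =
     ring.extend (free_ring Quot tensor_kernel \<iota> j)
       (module.fields (\<lambda>c A. pure_tensor \<iota> j 1 c \<otimes>\<^bsub>free_ring Quot tensor_kernel \<iota> j\<^esub> A))"


subsection \<open>Splitting fields and splitting representations\<close>

abbreviation mat_algebra :: "nat \<Rightarrow> ('k::field, 'k mat) module" where
  "mat_algebra d \<equiv> module_mat TYPE('k) d d"

definition algebra_iso :: "('k, 'a) module \<Rightarrow> ('k, 'b) module \<Rightarrow> ('a \<Rightarrow> 'b) set" where
  "algebra_iso A B =
     {\<phi> \<in> ring_iso A B. \<forall>c. \<forall>x \<in> carrier A. \<phi> (c \<odot>\<^bsub>A\<^esub> x) = c \<odot>\<^bsub>B\<^esub> \<phi> x}"

definition splitting_field ::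
    "('f::field \<Rightarrow> 'd::division_ring) \<Rightarrow> ('f \<Rightarrow> 'k::field) \<Rightarrow> nat \<Rightarrow> bool" where
  "splitting_field \<iota> j d \<longleftrightarrow>
     field_hom j \<and> algebra_iso (tensor_algebra \<iota> j) (mat_algebra d) \<noteq> {}"

definition splitting_representation ::
    "('f::field \<Rightarrow> 'd::division_ring) \<Rightarrow> ('f \<Rightarrow> 'k::field) \<Rightarrow> nat \<Rightarrow> ('d \<Rightarrow> 'k mat) \<Rightarrow> bool" where
  "splitting_representation \<iota> j d \<rho> \<longleftrightarrow>
     (\<exists>\<phi> \<in> algebra_iso (tensor_algebra \<iota> j) (mat_algebra d). \<forall>x. \<rho> x = \<phi> (pure_tensor \<iota> j x 1))"


subsection \<open>Monomial and diagonal subgroups of the general linear group\<close>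

definition GL :: "nat \<Rightarrow> 'k::field mat monoid" where
  "GL d = units_of (mat_algebra d)"

definition monomial_mat :: "'k::zero mat \<Rightarrow> bool" where
  "monomial_mat A \<longleftrightarrow>
     (\<forall>i < dim_row A. \<exists>!j. j < dim_col A \<and> A $$ (i, j) \<noteq> 0) \<and>
     (\<forall>j < dim_col A. \<exists>!i. i < dim_row A \<and> A $$ (i, j) \<noteq> 0)"

definition monomial_subgroup :: "nat \<Rightarrow> 'k::field mat set" where
  "monomial_subgroup d = {A \<in> carrier (GL d). monomial_mat A}"

definition diagonal_subgroup :: "nat \<Rightarrow> 'k::field mat set" where
  "diagonal_subgroup d = {A \<in> carrier (GL d). diagonal_mat A}"


subsection \<open>Well-definedness of the tensor product\<close>

lemma free_ring_simps:
  "carrier free_ring = UNIV" "zero free_ring = 0" "add free_ring = (+)"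
  "one free_ring = frag_of (1, 1)"
  by (simp_all add: free_ring_def)

lemma mult_free_ring_of:
  "frag_of (x, a) \<otimes>\<^bsub>free_ring\<^esub> frag_of (y, b) = frag_of (x * y, a * b)"
  by (simp add: free_ring_def)

lemma frag_extend_add_fun:
  "frag_extend (\<lambda>i. f i + g i) p = frag_extend f p + frag_extend g p"
  by (simp add: frag_extend_def frag_cmul_distrib2 sum.distrib)

lemma mult_free_ring_add:
  "(p + p') \<otimes>\<^bsub>free_ring\<^esub> q = p \<otimes>\<^bsub>free_ring\<^esub> q + p' \<otimes>\<^bsub>free_ring\<^esub> q"
  "p \<otimes>\<^bsub>free_ring\<^esub> (q + q') = p \<otimes>\<^bsub>free_ring\<^esub> q + p \<otimes>\<^bsub>free_ring\<^esub> q'"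
  by (simp_all add: free_ring_def frag_extend_add frag_extend_add_fun case_prod_unfold)

lemma mult_free_ring_minus:
  "(- p) \<otimes>\<^bsub>free_ring\<^esub> q = - (p \<otimes>\<^bsub>free_ring\<^esub> q)"
  "p \<otimes>\<^bsub>free_ring\<^esub> (- q) = - (p \<otimes>\<^bsub>free_ring\<^esub> q)"
  and mult_free_ring_zero:
  "0 \<otimes>\<^bsub>free_ring\<^esub> q = 0" "p \<otimes>\<^bsub>free_ring\<^esub> 0 = 0"
proof -
  show z: "0 \<otimes>\<^bsub>free_ring\<^esub> q = 0" "p \<otimes>\<^bsub>free_ring\<^esub> 0 = 0"
    using mult_free_ring_add(1)[of 0 0 q] mult_free_ring_add(2)[of p 0 0] by simp_all
  show "(- p) \<otimes>\<^bsub>free_ring\<^esub> q = - (p \<otimes>\<^bsub>free_ring\<^esub> q)"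
    using mult_free_ring_add(1)[of "- p" p q] z by (simp add: eq_neg_iff_add_eq_0)
  show "p \<otimes>\<^bsub>free_ring\<^esub> (- q) = - (p \<otimes>\<^bsub>free_ring\<^esub> q)"
    using mult_free_ring_add(2)[of p "- q" q] 
      mult_free_ring_add(2)[of p 0 0] by (simp add: eq_neg_iff_add_eq_0)
qed

lemma mult_free_ring_diff:
  "(p - p') \<otimes>\<^bsub>free_ring\<^esub> q = p \<otimes>\<^bsub>free_ring\<^esub> q - p' \<otimes>\<^bsub>free_ring\<^esub> q"
  "p \<otimes>\<^bsub>free_ring\<^esub> (q - q') = p \<otimes>\<^bsub>free_ring\<^esub> q - p \<otimes>\<^bsub>free_ring\<^esub> q'"
  using mult_free_ring_add(1)[of p "- p'" q] mult_free_ring_add(2)[of p q "- q'"]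
  by (simp_all add: mult_free_ring_minus)

lemma free_ring_induct [case_names zero of diff]:
  assumes "P 0" "\<And>x a. P (frag_of (x, a))" "\<And>p q. P p \<Longrightarrow> P q \<Longrightarrow> P (p - q)"
  shows "P (p :: 'd \<times> 'k \<Rightarrow>\<^sub>0 int)"
  by (rule frag_induction[of p UNIV P]) (use assms in auto)

lemma ring_free_ring:
  "ring (free_ring :: ('d::ring_1 \<times> 'k::comm_ring_1 \<Rightarrow>\<^sub>0 int) ring)" (is "ring ?R")
proof (rule ringI)
  show "abelian_group ?R"
    by (rule abelian_groupI) (auto simp: free_ring_simps add.assoc add.commute intro: exI[of _ "- _"])
  have assoc1: "(frag_of (x, a) \<otimes>\<^bsub>?R\<^esub> frag_of (y, b)) \<otimes>\<^bsub>?R\<^esub> r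
      = frag_of (x, a) \<otimes>\<^bsub>?R\<^esub> (frag_of (y, b) \<otimes>\<^bsub>?R\<^esub> r)" for x a y b r
    by (induction r rule: free_ring_induct)
      (simp_all add: mult_free_ring_of mult_free_ring_zero mult_free_ring_diff mult.assoc)
  have assoc2: "(frag_of (x, a) \<otimes>\<^bsub>?R\<^esub> q) \<otimes>\<^bsub>?R\<^esub> r
      = frag_of (x, a) \<otimes>\<^bsub>?R\<^esub> (q \<otimes>\<^bsub>?R\<^esub> r)" for x a q r
    by (induction q rule: free_ring_induct)
      (simp_all add: assoc1 mult_free_ring_zero mult_free_ring_diff)
  have assoc: "(p \<otimes>\<^bsub>?R\<^esub> q) \<otimes>\<^bsub>?R\<^esub> r = p \<otimes>\<^bsub>?R\<^esub> (q \<otimes>\<^bsub>?R\<^esub> r)" for p q r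
    by (induction p rule: free_ring_induct)
      (simp_all add: assoc2 mult_free_ring_zero mult_free_ring_diff)
  have one: "frag_of (1, 1) \<otimes>\<^bsub>?R\<^esub> p = p" "p \<otimes>\<^bsub>?R\<^esub> frag_of (1, 1) = p" for p
    by (induction p rule: free_ring_induct)
      (simp_all add: mult_free_ring_of mult_free_ring_zero mult_free_ring_diff)
  show "Group.monoid ?R"
    by (rule monoidI) (simp_all add: free_ring_simps assoc one)
qed (simp_all add: free_ring_simps mult_free_ring_add)

lemma tensor_kernel_ideal:
  fixes \<iota> :: "'f::field \<Rightarrow> 'd::ring_1" and j :: "'f \<Rightarrow> 'k::comm_ring_1"
  assumes central: "range \<iota> \<subseteq> center"
  shows "ideal (tensor_kernel \<iota> j) free_ring"
proof -
  let ?R = "free_ring :: ('d \<times> 'k \<Rightarrow>\<^sub>0 int) ring"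
  let ?I = "tensor_kernel \<iota> j"
  interpret R: ring ?R by (rule ring_free_ring)
  have sg: "subgroup ?I (add_monoid ?R)"
    unfolding tensor_kernel_def
    by (rule R.add.generate_is_subgroup) (simp add: free_ring_simps)
  have uminus_eq: "inv\<^bsub>add_monoid ?R\<^esub> p = - p" for p
    using R.add.inv_equality[of "- p" p] by (simp add: free_ring_simps a_inv_def)
  have zero: "0 \<in> ?I" and add: "\<And>p q. p \<in> ?I \<Longrightarrow> q \<in> ?I \<Longrightarrow> p + q \<in> ?I"
    using subgroup.one_closed[OF sg] subgroup.m_closed[OF sg] by (simp_all add: free_ring_simps)
  have minus: "p \<in> ?I \<Longrightarrow> - p \<in> ?I" for p
    using subgroup.m_inv_closed[OF sg, of p] unfolding uminus_eq .
  have diff: "p \<in> ?I \<Longrightarrow> q \<in> ?I \<Longrightarrow> p - q \<in> ?I" for p q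
    using add[of p "- q"] minus[of q] by simp
  have incl: "p \<in> tensor_relators \<iota> j \<Longrightarrow> p \<in> ?I" for p
    unfolding tensor_kernel_def by (rule generate.incl)
  have comm: "\<iota> c * x = x * \<iota> c" for c x
    using central by (auto simp: center_def)
  have rel: "p \<otimes>\<^bsub>?R\<^esub> frag_of (z, e) \<in> ?I \<and> frag_of (z, e) \<otimes>\<^bsub>?R\<^esub> p \<in> ?I"
    if "p \<in> tensor_relators \<iota> j" for p z e
  proof -
    from that consider
        x y a where "p = frag_of (x + y, a) - frag_of (x, a) - frag_of (y, a)"
      | x a b where "p = frag_of (x, a + b) - frag_of (x, a) - frag_of (x, b)"
      | x c a where "p = frag_of (x * \<iota> c, a) - frag_of (x, j c * a)"
      unfolding tensor_relators_def by blast
    then have "p \<otimes>\<^bsub>?R\<^esub> frag_of (z, e) \<in> tensor_relators \<iota> j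
        \<and> frag_of (z, e) \<otimes>\<^bsub>?R\<^esub> p \<in> tensor_relators \<iota> j"
    proof cases
      case 1
      then show ?thesis unfolding tensor_relators_def
        by (simp add: mult_free_ring_diff mult_free_ring_of distrib_left distrib_right) blast
    next
      case 2
      then show ?thesis unfolding tensor_relators_def
        by (simp add: mult_free_ring_diff mult_free_ring_of distrib_left distrib_right) blast
    next
      case 3
      have "x * \<iota> c * z = (x * z) * \<iota> c" "z * (x * \<iota> c) = (z * x) * \<iota> c"
        "j c * a * e = j c * (a * e)" "e * (j c * a) = j c * (e * a)"
        by (simp_all add: mult.assoc comm mult.left_commute)
      then have "p \<otimes>\<^bsub>?R\<^esub> frag_of (z, e)
            = frag_of ((x * z) * \<iota> c, a * e) - frag_of (x * z, j c * (a * e))"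
        "frag_of (z, e) \<otimes>\<^bsub>?R\<^esub> p
            = frag_of ((z * x) * \<iota> c, e * a) - frag_of (z * x, j c * (e * a))"
        unfolding 3 mult_free_ring_diff mult_free_ring_of by (simp_all only:)
      then show ?thesis unfolding tensor_relators_def by blast
    qed
    then show ?thesis using incl by blast
  qed
  have rel': "p \<otimes>\<^bsub>?R\<^esub> q \<in> ?I \<and> q \<otimes>\<^bsub>?R\<^esub> p \<in> ?I" if "p \<in> tensor_relators \<iota> j" for p q
    by (induction q rule: free_ring_induct)
      (use rel[OF that] diff zero in \<open>simp_all add: mult_free_ring_zero mult_free_ring_diff\<close>)
  have ker: "p \<otimes>\<^bsub>?R\<^esub> q \<in> ?I \<and> q \<otimes>\<^bsub>?R\<^esub> p \<in> ?I" if "p \<in> ?I" for p q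
    using that unfolding tensor_kernel_def
  proof (induction p rule: generate.induct)
    case one
    then show ?case
      using zero by (simp add: free_ring_simps mult_free_ring_zero tensor_kernel_def)
  next
    case (incl h)
    then show ?case using rel' by (simp add: tensor_kernel_def)
  next
    case (inv h)
    then show ?case using rel'[of h q] minus
      unfolding uminus_eq mult_free_ring_minus tensor_kernel_def[symmetric] by blast
  next
    case (eng h1 h2)
    then show ?case using add
      by (simp add: free_ring_simps mult_free_ring_add tensor_kernel_def)
  qed
  show ?thesis
    by (rule idealI) (use ring_free_ring sg ker in auto)
qed

end

theory Submission
  imports Defs "HOL-Algebra.Embedded_Algebras" "Jordan_Normal_Form.Determinant"
begin

text \<open>
  The coset \<open>X\<close> is that of the permutation matrix of a cycle of length \<open>d - 1\<close> together with one
  fixed point. A conjugate of a splitting representation is again a splitting representation,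
  so it suffices that no \<open>P = \<rho> x\<close> lies in \<open>X\<close> (\<open>not_cycle_shaped\<close>).

  Suppose that \<open>P = \<rho> x\<close> has this shape. Then \<open>P\<^bsup>d-1\<^esup>\<close> acts on the cycle as a scalar \<open>a\<close> and \<open>P\<close> acts on
  the fixed point as a scalar \<open>b\<close>, so \<open>(P - b) (P\<^bsup>d-1\<^esup> - a) = 0\<close>, while \<open>1, P, \<dots>, P\<^bsup>d-2\<^esup>\<close> are linearly
  independent over \<open>K\<close>. Since \<open>D \<otimes>\<^sub>F K \<cong> M\<^sub>d(K)\<close>, elements of \<open>D\<close> that are independent over \<open>F\<close> stay
  independent over \<open>K\<close> (\<open>independent_over_extension\<close>); hence \<open>x\<close> has degree \<open>d - 1\<close> or \<open>d\<close> over \<open>F\<close>.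

  If the degree is \<open>d\<close>, the relation above is the minimal polynomial of \<open>x\<close>. As \<open>d > 2\<close>, its
  coefficient at \<open>x\<^bsup>d-1\<^esup>\<close> is \<open>-b\<close> alone, so \<open>b\<close> lies in \<open>F\<close>. Then \<open>x - b\<close> is an element of \<open>D\<close> whose matrix
  has a zero row, so it is \<open>0\<close>, and \<open>P\<close> would be scalar. If the degree is \<open>d - 1\<close>, then \<open>D\<close> is a left
  vector space over the field \<open>F[x]\<close>, so \<open>d - 1\<close> divides \<open>dim\<^sub>F D = d\<^sup>2\<close> (\<open>monogenic_degree_dvd\<close>), hence
  divides \<open>d\<^sup>2 - (d - 1) (d + 1) = 1\<close>, against \<open>d > 2\<close>.
\<close>

section \<open>Subfields of a division ring\<close>

text \<open>
  The type as a ring with an explicit carrier: dimensions over subfields that are mere subsets,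
  and their multiplicativity in towers, are available in this form.
\<close>

definition ring_of_type :: "'d::ring_1 ring" where
  "ring_of_type = \<lparr>carrier = UNIV, mult = (*), one = 1, zero = 0, add = (+)\<rparr>"

lemma ring_of_type_simps:
  "carrier ring_of_type = UNIV" "mult ring_of_type = (*)" "one ring_of_type = 1"
  "zero ring_of_type = 0" "add ring_of_type = (+)"
  by (simp_all add: ring_of_type_def)

interpretation type_ring: ring "ring_of_type :: 'd::ring_1 ring"
proof (rule ringI)
  show "abelian_group (ring_of_type :: 'd ring)"
    by (rule abelian_groupI)
      (auto simp: ring_of_type_simps add.assoc add.commute intro: exI[of _ "- _"])
  show "Group.monoid (ring_of_type :: 'd ring)"
    by (rule Group.monoidI) (simp_all add: ring_of_type_simps mult.assoc)
qed (simp_all add: ring_of_type_simps algebra_simps)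

lemma a_inv_ring_of_type: "\<ominus>\<^bsub>ring_of_type\<^esub> (x :: 'd::ring_1) = - x"
  using type_ring.minus_equality[of "- x" x] by (simp add: ring_of_type_simps)

lemma subfield_of_typeI:
  fixes L :: "'d::division_ring set"
  assumes "1 \<in> L" "\<And>x. x \<in> L \<Longrightarrow> - x \<in> L" "\<And>x y. x \<in> L \<Longrightarrow> y \<in> L \<Longrightarrow> x + y \<in> L"
    and "\<And>x y. x \<in> L \<Longrightarrow> y \<in> L \<Longrightarrow> x * y \<in> L" "\<And>x y. x \<in> L \<Longrightarrow> y \<in> L \<Longrightarrow> x * y = y * x"
    and "\<And>x. x \<in> L \<Longrightarrow> x \<noteq> 0 \<Longrightarrow> \<exists>y\<in>L. x * y = 1"
  shows "subfield L ring_of_type"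
proof (rule type_ring.subfieldI)
  show "subcring L ring_of_type"
    by (intro type_ring.subcringI type_ring.subringI)
      (use assms in \<open>auto simp: ring_of_type_simps a_inv_ring_of_type\<close>)
  show "Units (ring_of_type\<lparr>carrier := L\<rparr>) = L - {\<zero>\<^bsub>ring_of_type\<^esub>}"
    using assms(5,6) by (force simp: Units_def ring_of_type_simps)
qed

section \<open>Degrees in a central division algebra\<close>

locale central_division =
  fixes \<iota> :: "'f::field \<Rightarrow> 'd::division_ring" and d :: nat
  assumes central: "central_division_algebra \<iota> d"
begin

sublocale \<iota>: Ring_Hom.ring_hom \<iota>
  using central by (simp add: central_division_algebra_def)

lemma \<iota>_commute: "\<iota> c * x = x * \<iota> c"
  using central by (auto simp: central_division_algebra_def center_def)

sublocale D: vector_space "\<lambda>c x. \<iota> c * x"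
  by unfold_locales (simp_all add: algebra_simps \<iota>.hom_add \<iota>.hom_mult)

lemma dim_D: "D.dim (UNIV :: 'd set) = d\<^sup>2" and d_pos: "0 < d"
  using central by (simp_all add: central_division_algebra_def)

text \<open>
  The coordinates with respect to a basis extending \<open>B\<close> separate the elements of \<open>B\<close>. These
  functionals are what is extended to \<open>K\<close> when independence is carried over to matrices.
\<close>

lemma independent_coordinate_functional:
  assumes "D.independent B" "y \<in> B"
  obtains l :: "'d \<Rightarrow> 'f" where "\<And>u v. l (u + v) = l u + l v" "\<And>c u. l (\<iota> c * u) = c * l u"
    "\<And>z. z \<in> B \<Longrightarrow> l z = (if z = y then 1 else 0)"
proof
  let ?E = "D.extend_basis B"
  have E: "D.independent ?E" "D.span ?E = UNIV" "B \<subseteq> ?E"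
    using assms D.independent_extend_basis D.span_extend_basis D.extend_basis_superset by auto
  let ?l = "\<lambda>v. D.representation ?E v y"
  show "?l (u + v) = ?l u + ?l v" for u v using E by (simp add: D.representation_add)
  show "?l (\<iota> c * u) = c * ?l u" for c u using E by (simp add: D.representation_scale)
  show "?l z = (if z = y then 1 else 0)" if "z \<in> B" for z
    using that E by (subst D.representation_basis) auto
qed

lemma \<iota>_left_commute: "x * (\<iota> c * y) = \<iota> c * (x * y)"
  by (metis \<iota>_commute mult.assoc)

lemma scalars_subfield: "subfield (range \<iota>) ring_of_type"
proof (rule subfield_of_typeI)
  fix x assume x: "x \<in> range \<iota>" "x \<noteq> 0"
  then obtain c where c: "x = \<iota> c" by blast
  with x(2) have "c \<noteq> 0" by auto
  then have "x * \<iota> (inverse c) = 1" using \<iota>.hom_mult[of c "inverse c"] c by simp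
  then show "\<exists>y\<in>range \<iota>. x * y = 1" by blast
next
  show "1 \<in> range \<iota>" by (rule range_eqI[where f=\<iota> and x=1]) simp
  show "- x \<in> range \<iota>" if "x \<in> range \<iota>" for x
    using that by (auto intro: range_eqI[where f=\<iota>] \<iota>.hom_uminus[symmetric])
  show "x + y \<in> range \<iota>" if "x \<in> range \<iota>" "y \<in> range \<iota>" for x y
    using that by (auto intro: range_eqI[where f=\<iota>] \<iota>.hom_add[symmetric])
  show "x * y \<in> range \<iota>" if "x \<in> range \<iota>" "y \<in> range \<iota>" for x y
    using that by (auto intro: range_eqI[where f=\<iota>] \<iota>.hom_mult[symmetric])
  show "x * y = y * x" if "x \<in> range \<iota>" for x y
    using that by (auto simp: \<iota>_commute)
qed

text \<open>
  This links the dimension in the definition of a central division algebra with the dimensions for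
  which the tower law holds; both count the vectors adjoined one at a time.
\<close>

lemma dimension_span:
  assumes "finite B" "D.independent B"
  shows "type_ring.dimension (card B) (range \<iota>) (D.span B)"
  using assms
proof (induction B rule: finite_induct)
  case empty
  then show ?case using type_ring.zero_dim[of "range \<iota>"] by (simp add: ring_of_type_simps)
next
  case (insert v B)
  then have v: "v \<notin> D.span B" "D.independent B" by (simp_all add: D.independent_insert)
  have "D.span (insert v B) = type_ring.line_extension (range \<iota>) v (D.span B)"
  proof (rule equalityI; rule subsetI)
    fix u assume "u \<in> D.span (insert v B)"
    then obtain k where "u - \<iota> k * v \<in> D.span B" by (auto simp: D.span_breakdown_eq)
    then show "u \<in> type_ring.line_extension (range \<iota>) v (D.span B)"
      unfolding type_ring.line_extension_mem_iff ring_of_type_simps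
      by (intro bexI[of _ "\<iota> k"] bexI[of _ "u - \<iota> k * v"]) auto
  next
    fix u assume "u \<in> type_ring.line_extension (range \<iota>) v (D.span B)"
    then obtain k w where "w \<in> D.span B" "u = \<iota> k * v + w"
      unfolding type_ring.line_extension_mem_iff ring_of_type_simps by blast
    then have "u - \<iota> k * v \<in> D.span B" by simp
    then show "u \<in> D.span (insert v B)" unfolding D.span_breakdown_eq by blast
  qed
  then show ?case
    using type_ring.Suc_dim[of v "D.span B" "card B" "range \<iota>"] insert v
    by (simp add: ring_of_type_simps)
qed

lemma finite_basis:
  obtains B where "finite B" "D.independent B" "D.span B = UNIV" "card B = d\<^sup>2"
proof -
  obtain B where B: "D.independent B" "UNIV \<subseteq> D.span B" "card B = D.dim (UNIV :: 'd set)"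
    using D.basis_exists[of UNIV] by blast
  moreover have "finite B" using B(3) dim_D d_pos by (intro card_ge_0_finite) simp
  ultimately show ?thesis using that dim_D by auto
qed

text \<open>
  A finite basis over \<open>F\<close> also spans over \<open>L\<close>, so the dimension \<open>m\<close> over \<open>L\<close> exists, and the tower
  law gives \<open>d\<^sup>2 = [L : F] m\<close>.
\<close>

lemma subfield_degree_dvd:
  assumes L: "subfield L ring_of_type" "range \<iota> \<subseteq> L"
    and B: "finite B" "D.independent B" "D.span B = L"
  shows "card B dvd d\<^sup>2"
proof -
  obtain E where E: "finite E" "D.independent E" "D.span E = UNIV" "card E = d\<^sup>2"
    by (rule finite_basis)
  obtain Us where Us: "set Us = E" using E(1) finite_list by blast
  have Us_carrier: "set Us \<subseteq> carrier ring_of_type" by (simp add: ring_of_type_simps)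
  note span = type_ring.Span_subgroup_props[OF L(1) Us_carrier]
    type_ring.Span_smult_closed[OF L(1) Us_carrier] type_ring.Span_base_incl[OF L(1) Us_carrier]
  have scalar: "\<iota> c \<in> L" for c using L(2) by auto
  have "D.subspace (type_ring.Span L Us)"
    using span(2,3) span(5)[OF scalar] unfolding ring_of_type_simps by (rule D.subspaceI)
  then have "D.span E \<subseteq> type_ring.Span L Us"
    using span(6) Us by (intro D.span_minimal) simp_all
  then have "type_ring.Span L Us = UNIV" using E(3) by auto
  then obtain m where m: "type_ring.dimension m L UNIV"
    using type_ring.Span_finite_dimension[OF L(1) Us_carrier] by (auto simp: type_ring.finite_dimension_def)
  have "type_ring.dimension (card B * m) (range \<iota>) UNIV"
    using type_ring.telescopic_base[OF scalars_subfield L(1) _ m] dimension_span[OF B(1,2)] B(3) by simp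
  moreover have "type_ring.dimension (d\<^sup>2) (range \<iota>) UNIV"
    using dimension_span[OF E(1,2)] E(3,4) by simp
  ultimately have "d\<^sup>2 = card B * m"
    using type_ring.dimension_is_inj[OF scalars_subfield] by blast
  then show ?thesis by simp
qed

text \<open>
  Left multiplication by \<open>y\<close> is injective on a space of finite dimension, so it is onto and
  attains \<open>1\<close>.
\<close>

lemma subalgebra_inverse_closed:
  assumes B: "finite B" "D.independent B"
    and mult: "\<And>x y. x \<in> D.span B \<Longrightarrow> y \<in> D.span B \<Longrightarrow> x * y \<in> D.span B"
    and y: "y \<in> D.span B" "y \<noteq> 0" and "1 \<in> D.span B"
  shows "\<exists>z\<in>D.span B. y * z = 1"
proof -
  obtain E where E: "finite E" "D.independent E" "D.span E = UNIV" by (rule finite_basis)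
  interpret finite_dimensional_vector_space "\<lambda>c x. \<iota> c * x" E
    by unfold_locales (use E in auto)
  interpret P: vector_space_pair "\<lambda>c x. \<iota> c * x" "\<lambda>c x. \<iota> c * x" ..
  have lin: "Vector_Spaces.linear (\<lambda>c x. \<iota> c * x) (\<lambda>c x. \<iota> c * x) ((*) y)"
    by unfold_locales (metis \<iota>_commute distrib_left mult.assoc)+
  have inj: "inj ((*) y)" using y(2) by (auto intro: injI)
  have "D.independent ((*) y ` B)"
    by (rule P.linear_independent_injective_image[OF lin B(2)]) (use inj inj_on_subset in blast)
  then have "D.span B \<subseteq> D.span ((*) y ` B)"
  proof (rule card_ge_dim_independent[rotated])
    show "(*) y ` B \<subseteq> D.span B" using mult[OF y(1)] D.span_base by blast
    have "card ((*) y ` B) = card B" by (rule card_image[OF inj_on_subset[OF inj subset_UNIV]])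
    then show "D.dim (D.span B) \<le> card ((*) y ` B)"
      using B(2) by (simp add: D.dim_eq_card_independent)
  qed
  also have "\<dots> = (*) y ` D.span B" by (rule P.linear_span_image[OF lin])
  finally show ?thesis using assms(6) by force
qed

text \<open>
  The powers below \<open>n\<close> span \<open>F[x]\<close>, which is commutative as \<open>F\<close> is central and a field as it has
  finite dimension in a division ring.
\<close>

lemma monogenic_degree_dvd:
  assumes n: "0 < n" and inj: "inj_on ((^) x) {..<n}" and indep: "D.independent ((^) x ` {..<n})"
    and rel: "x ^ n \<in> D.span ((^) x ` {..<n})"
  shows "n dvd d\<^sup>2"
proof -
  let ?B = "(^) x ` {..<n}" and ?L = "D.span ((^) x ` {..<n})"
  have pow: "x ^ i \<in> ?L" if "i < n" for i using that by (intro D.span_base) auto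
  have one: "1 \<in> ?L" using pow[OF n] by simp
  have scale: "\<iota> c \<in> ?L" for c using D.span_scale[OF one, of c] by simp
  have x_mult: "x * z \<in> ?L" if "z \<in> ?L" for z
    using that
  proof (induction rule: D.span_induct_alt)
    case base
    then show ?case by (simp add: D.span_zero)
  next
    case (step c u z)
    then obtain i where i: "u = x ^ i" "i < n" by auto
    have "x * u \<in> ?L" using i rel pow[of "Suc i"] by (cases "Suc i = n") auto
    then have "\<iota> c * (x * u) + x * z \<in> ?L" using step by (intro D.span_add D.span_scale)
    moreover have "x * (\<iota> c * u + z) = \<iota> c * (x * u) + x * z"
      by (simp add: distrib_left \<iota>_left_commute)
    ultimately show ?case by simp
  qed
  have pow_mult: "x ^ i * z \<in> ?L" if "z \<in> ?L" for i z
    using that by (induction i) (auto simp: x_mult mult.assoc)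
  have mult: "y * z \<in> ?L" if "y \<in> ?L" "z \<in> ?L" for y z
    using that(1)
    by (induction rule: D.span_induct_alt)
      (auto simp: distrib_right mult.assoc D.span_zero intro!: D.span_add D.span_scale pow_mult that(2))
  have x_comm: "x * y = y * x" if "y \<in> ?L" for y
    using that
  proof (induction rule: D.span_induct_alt)
    case (step c u z)
    then have "x * u = u * x" by (auto simp: power_commutes)
    then have "x * (\<iota> c * u) = \<iota> c * u * x" by (simp add: \<iota>_left_commute mult.assoc)
    then show ?case using step by (simp add: algebra_simps)
  qed simp
  have pow_comm: "x ^ i * y = y * x ^ i" if "y \<in> ?L" for i y
  proof (induction i)
    case (Suc i)
    have "x ^ Suc i * y = x * (y * x ^ i)" using Suc by (simp add: mult.assoc)
    also have "\<dots> = y * x ^ Suc i" using x_comm[OF that] by (simp flip: mult.assoc)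
    finally show ?case .
  qed simp
  have comm: "y * z = z * y" if "y \<in> ?L" "z \<in> ?L" for y z
    using that(1)
  proof (induction rule: D.span_induct_alt)
    case (step c u w)
    then have "u * z = z * u" using pow_comm[OF that(2)] by auto
    then have "\<iota> c * u * z = z * (\<iota> c * u)" by (simp add: \<iota>_left_commute mult.assoc)
    then show ?case using step by (simp add: algebra_simps)
  qed simp
  have "subfield ?L ring_of_type"
    using subalgebra_inverse_closed[of ?B] indep mult one comm
    by (intro subfield_of_typeI) (auto intro: D.span_neg D.span_add)
  then have "card ?B dvd d\<^sup>2"
    using indep scale by (intro subfield_degree_dvd) auto
  then show ?thesis using inj by (simp add: card_image)
qed

lemma span_lessThan_sum:
  fixes n :: nat
  assumes "z \<in> D.span (y ` {..<n})"
  shows "\<exists>c. z = (\<Sum>i<n. \<iota> (c i) * y i)"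
  using assms
proof (induction n arbitrary: z)
  case 0
  then show ?case by simp
next
  case (Suc n)
  then obtain k where "z - \<iota> k * y n \<in> D.span (y ` {..<n})"
    by (auto simp: lessThan_Suc D.span_breakdown_eq)
  then obtain c where "z - \<iota> k * y n = (\<Sum>i<n. \<iota> (c i) * y i)" using Suc.IH by blast
  then have "z = (\<Sum>i<Suc n. \<iota> ((c(n := k)) i) * y i)" by (simp add: algebra_simps)
  then show ?case by blast
qed

text \<open>
  Injectivity excludes repetitions, which the independence of the set of powers would hide.
\<close>

definition power_independent :: "'d \<Rightarrow> nat \<Rightarrow> bool" where
  "power_independent x n \<longleftrightarrow> inj_on ((^) x) {..<n} \<and> D.independent ((^) x ` {..<n})"

lemma power_independent_Suc:
  "power_independent x (Suc n) \<longleftrightarrow> power_independent x n \<and> x ^ n \<notin> D.span ((^) x ` {..<n})"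
  using D.span_base[of "x ^ n" "(^) x ` {..<n}"]
  by (auto simp: power_independent_def lessThan_Suc D.independent_insert)

end

section \<open>Linear independence over a splitting field\<close>

text \<open>
  The additive extension of \<open>\<beta>\<close> from pairs to the free abelian group on them.
\<close>

definition bilinear_lift :: "('d \<Rightarrow> 'k::comm_ring_1 \<Rightarrow> 'k) \<Rightarrow> ('d \<times> 'k \<Rightarrow>\<^sub>0 int) \<Rightarrow> 'k" where
  "bilinear_lift \<beta> p =
     (\<Sum>(x, a)\<in>Poly_Mapping.keys p. of_int (Poly_Mapping.lookup p (x, a)) * \<beta> x a)"

lemma bilinear_lift_superset:
  assumes "finite S" "Poly_Mapping.keys p \<subseteq> S"
  shows "bilinear_lift \<beta> p = (\<Sum>(x, a)\<in>S. of_int (Poly_Mapping.lookup p (x, a)) * \<beta> x a)"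
  unfolding bilinear_lift_def
  by (rule sum.mono_neutral_left) (use assms in \<open>auto simp: in_keys_iff\<close>)

lemma bilinear_lift_add: "bilinear_lift \<beta> (p + q) = bilinear_lift \<beta> p + bilinear_lift \<beta> q"
proof -
  let ?S = "Poly_Mapping.keys p \<union> Poly_Mapping.keys q"
  have "bilinear_lift \<beta> r = (\<Sum>(x, a)\<in>?S. of_int (Poly_Mapping.lookup r (x, a)) * \<beta> x a)"
    if "Poly_Mapping.keys r \<subseteq> ?S" for r
    by (rule bilinear_lift_superset) (use that in auto)
  then show ?thesis
    using keys_add[of p q]
    by (simp add: lookup_add algebra_simps sum.distrib case_prod_unfold)
qed

lemma bilinear_lift_zero: "bilinear_lift \<beta> 0 = 0"
  by (simp add: bilinear_lift_def)

lemma bilinear_lift_minus: "bilinear_lift \<beta> (- p) = - bilinear_lift \<beta> p"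
  using bilinear_lift_add[of \<beta> p "- p"] by (simp add: bilinear_lift_zero eq_neg_iff_add_eq_0 add.commute)

lemma bilinear_lift_diff: "bilinear_lift \<beta> (p - q) = bilinear_lift \<beta> p - bilinear_lift \<beta> q"
  using bilinear_lift_add[of \<beta> p "- q"] by (simp add: bilinear_lift_minus)

lemma bilinear_lift_of: "bilinear_lift \<beta> (frag_of (x, a)) = \<beta> x a"
  by (simp add: bilinear_lift_def)

lemma bilinear_lift_sum: "bilinear_lift \<beta> (\<Sum>i\<in>I. p i) = (\<Sum>i\<in>I. bilinear_lift \<beta> (p i))"
  by (induction I rule: infinite_finite_induct) (simp_all add: bilinear_lift_zero bilinear_lift_add)

lemma one_smult_mat: "1 \<cdot>\<^sub>m (A :: 'a::monoid_mult mat) = A"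
  by (rule eq_matI) simp_all

locale split_algebra = central_division \<iota> d
  for \<iota> :: "'f::field \<Rightarrow> 'd::division_ring" and d +
  fixes j :: "'f \<Rightarrow> 'k::field" and \<rho> :: "'d \<Rightarrow> 'k mat"
  assumes hom_j: "field_hom j"
    and splitting: "splitting_representation \<iota> j d \<rho>"
begin

sublocale j: field_hom j by (rule hom_j)

lemma tensor_algebra_simps:
  "carrier (tensor_algebra \<iota> j) = carrier (free_ring Quot tensor_kernel \<iota> j)"
  "mult (tensor_algebra \<iota> j) = mult (free_ring Quot tensor_kernel \<iota> j)"
  "add (tensor_algebra \<iota> j) = add (free_ring Quot tensor_kernel \<iota> j)"
  "one (tensor_algebra \<iota> j) = one (free_ring Quot tensor_kernel \<iota> j)"
  "zero (tensor_algebra \<iota> j) = zero (free_ring Quot tensor_kernel \<iota> j)"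
  "c \<odot>\<^bsub>tensor_algebra \<iota> j\<^esub> A =
     pure_tensor \<iota> j 1 c \<otimes>\<^bsub>free_ring Quot tensor_kernel \<iota> j\<^esub> A"
  by (simp_all add: tensor_algebra_def ring.defs module.defs)

sublocale ker: ideal "tensor_kernel \<iota> j" free_ring
  using tensor_kernel_ideal[of \<iota> j] central by (simp add: central_division_algebra_def)

text \<open>
  Balanced biadditive maps factor through the tensor product.
\<close>

lemma bilinear_lift_kernel:
  assumes "\<And>x y a. \<beta> (x + y) a = \<beta> x a + \<beta> y a"
    and "\<And>x a b. \<beta> x (a + b) = \<beta> x a + \<beta> x b"
    and "\<And>x c a. \<beta> (x * \<iota> c) a = \<beta> x (j c * a)"
    and "p \<in> tensor_kernel \<iota> j"
  shows "bilinear_lift \<beta> p = 0"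
proof -
  have rel: "bilinear_lift \<beta> r = 0" if "r \<in> tensor_relators \<iota> j" for r
    using that assms(1-3) by (auto simp: tensor_relators_def bilinear_lift_diff bilinear_lift_of)
  have lift_inv: "bilinear_lift \<beta> (inv\<^bsub>add_monoid free_ring\<^esub> r) = - bilinear_lift \<beta> r" for r
    using ker.add.inv_equality[of "- r" r]
    by (simp add: free_ring_simps bilinear_lift_minus a_inv_def)
  show ?thesis
    using assms(4) unfolding tensor_kernel_def
  proof (induction p rule: generate.induct)
    case (inv h)
    then show ?case using lift_inv[of h] rel[of h] by simp
  qed (simp_all add: rel free_ring_simps bilinear_lift_zero bilinear_lift_add)
qed

text \<open>
  If \<open>\<Sum> y\<^sub>i \<otimes> k\<^sub>i = 0\<close>, applying the balanced map \<open>(x, a) \<mapsto> j (l x) a\<close> for the functional \<open>l\<close> dual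
  to \<open>y\<^sub>i\<close> leaves only \<open>k\<^sub>i\<close>.
\<close>

lemma sum_tensor_in_kernel_imp_zero:
  assumes "finite I" "inj_on y I" "D.independent (y ` I)"
    and "(\<Sum>i\<in>I. frag_of (y i, k i)) \<in> tensor_kernel \<iota> j" and "i \<in> I"
  shows "k i = 0"
proof -
  obtain l :: "'d \<Rightarrow> 'f" where l: "\<And>u v. l (u + v) = l u + l v" "\<And>c u. l (\<iota> c * u) = c * l u"
    "\<And>z. z \<in> y ` I \<Longrightarrow> l z = (if z = y i then 1 else 0)"
    using independent_coordinate_functional[OF assms(3), of "y i"] assms(5) by blast
  have "0 = bilinear_lift (\<lambda>x a. j (l x) * a) (\<Sum>i\<in>I. frag_of (y i, k i))"
    by (rule sym, rule bilinear_lift_kernel[OF _ _ _ assms(4)])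
      (simp_all add: l j.hom_add j.hom_mult algebra_simps flip: \<iota>_commute)
  also have "\<dots> = (\<Sum>i'\<in>I. j (l (y i')) * k i')"
    by (simp add: bilinear_lift_sum bilinear_lift_of)
  also have "\<dots> = (\<Sum>i'\<in>I. if i' = i then k i' else 0)"
    by (rule sum.cong) (use l(3) assms(2,5) in \<open>auto simp: inj_on_eq_iff\<close>)
  also have "\<dots> = k i" using assms(1,5) by simp
  finally show ?thesis by simp
qed

text \<open>
  Composing the isomorphism with the quotient map replaces calculations with cosets by
  calculations in the free ring, where all tensors are represented by sums of pairs.
\<close>

lemma representation_as_lift:
  obtains \<Phi> :: "('d \<times> 'k \<Rightarrow>\<^sub>0 int) \<Rightarrow> 'k mat"
  where "\<And>p. \<Phi> p \<in> carrier_mat d d" "\<And>p q. \<Phi> (p + q) = \<Phi> p + \<Phi> q"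
    and "\<And>p q. \<Phi> (p \<otimes>\<^bsub>free_ring\<^esub> q) = \<Phi> p * \<Phi> q" "\<Phi> (frag_of (1, 1)) = 1\<^sub>m d"
    and "\<And>x a. \<Phi> (frag_of (x, a)) = a \<cdot>\<^sub>m \<rho> x"
    and "\<And>p. \<Phi> p = 0\<^sub>m d d \<longleftrightarrow> p \<in> tensor_kernel \<iota> j"
proof -
  let ?I = "tensor_kernel \<iota> j"
  let ?Q = "free_ring Quot ?I :: ('d \<times> 'k \<Rightarrow>\<^sub>0 int) set ring"
  from splitting obtain \<phi> where \<phi>: "\<phi> \<in> algebra_iso (tensor_algebra \<iota> j) (mat_algebra d)"
    and \<rho>: "\<And>x. \<rho> x = \<phi> (pure_tensor \<iota> j x 1)"
    unfolding splitting_representation_def by blast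
  have hom: "\<phi> \<in> ring_hom ?Q (mat_algebra d)" and inj: "inj_on \<phi> (carrier ?Q)"
    and smult: "\<And>c A. A \<in> carrier ?Q \<Longrightarrow> \<phi> (pure_tensor \<iota> j 1 c \<otimes>\<^bsub>?Q\<^esub> A) = c \<cdot>\<^sub>m \<phi> A"
    using \<phi> by (auto simp: algebra_iso_def ring_iso_def ring_hom_def bij_betw_def
      tensor_algebra_simps module_mat_simps)
  let ?q = "\<lambda>p. ?I +>\<^bsub>free_ring\<^esub> p"
  have q: "?q \<in> ring_hom free_ring ?Q" by (rule ker.rcos_ring_hom)
  have qc: "?q p \<in> carrier ?Q" for p using q by (auto simp: ring_hom_def free_ring_simps)
  show ?thesis
  proof
    have lift: "\<phi> \<circ> ?q \<in> ring_hom free_ring (mat_algebra d)"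
      using q hom by (rule ring_hom_trans)
    show "(\<phi> \<circ> ?q) p \<in> carrier_mat d d" for p
      using ring_hom_closed[OF lift] by (simp add: free_ring_simps module_mat_simps)
    show "(\<phi> \<circ> ?q) (p + p') = (\<phi> \<circ> ?q) p + (\<phi> \<circ> ?q) p'" for p p'
      using ring_hom_add[OF lift] by (simp add: free_ring_simps module_mat_simps)
    show "(\<phi> \<circ> ?q) (p \<otimes>\<^bsub>free_ring\<^esub> p') = (\<phi> \<circ> ?q) p * (\<phi> \<circ> ?q) p'" for p p'
      using ring_hom_mult[OF lift] by (simp add: free_ring_simps module_mat_simps)
    show "(\<phi> \<circ> ?q) (frag_of (1, 1)) = 1\<^sub>m d"
      using ring_hom_one[OF lift] by (simp add: free_ring_simps module_mat_simps)
    show "(\<phi> \<circ> ?q) (frag_of (x, a)) = a \<cdot>\<^sub>m \<rho> x" for x a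
    proof -
      have "?q (frag_of (x, a)) = pure_tensor \<iota> j 1 a \<otimes>\<^bsub>?Q\<^esub> pure_tensor \<iota> j x 1"
        using ring_hom_mult[OF q, of "frag_of (1, a)" "frag_of (x, 1)"]
        by (simp add: free_ring_simps mult_free_ring_of pure_tensor_def)
      then show ?thesis using smult[OF qc, of a "frag_of (x, 1)"] by (simp add: \<rho> pure_tensor_def)
    qed
    show "(\<phi> \<circ> ?q) p = 0\<^sub>m d d \<longleftrightarrow> p \<in> ?I" for p
    proof -
      interpret Q: ring ?Q by (rule ker.quotient_is_ring)
      interpret M: ring "mat_algebra d :: ('k, 'k mat) module"
        using ring_mat[where 'a='k and n=d] by (simp add: module_mat_def ring_mat_def)
      have zero: "\<phi> \<zero>\<^bsub>?Q\<^esub> = 0\<^sub>m d d"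
        using ring_hom_zero[OF hom Q.ring_axioms M.ring_axioms] by (simp add: module_mat_simps)
      have "(\<phi> \<circ> ?q) p = 0\<^sub>m d d \<longleftrightarrow> ?q p = \<zero>\<^bsub>?Q\<^esub>"
        using inj_onD[OF inj, of "?q p" "\<zero>\<^bsub>?Q\<^esub>"] qc zero by auto
      also have "\<dots> \<longleftrightarrow> p \<in> ?I"
        using ker.rcos_const_imp_mem[of p] ker.a_rcos_zero[OF ker.ideal_axioms, of p]
        by (auto simp: FactRing_def free_ring_simps)
      finally show ?thesis .
    qed
  qed
qed

text \<open>
  The relators of the tensor product give additivity and the value on scalars.
\<close>

lemma \<rho>_carrier [simp]: "\<rho> x \<in> carrier_mat d d"
  and \<rho>_add: "\<rho> (x + y) = \<rho> x + \<rho> y"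
  and \<rho>_mult: "\<rho> (x * y) = \<rho> x * \<rho> y"
  and \<rho>_scalar: "\<rho> (\<iota> c) = j c \<cdot>\<^sub>m 1\<^sub>m d"
proof -
  obtain \<Phi> where carrier: "\<And>p. \<Phi> p \<in> carrier_mat d d"
    and add: "\<And>p q. \<Phi> (p + q) = \<Phi> p + \<Phi> q"
    and mult: "\<And>p q. \<Phi> (p \<otimes>\<^bsub>free_ring\<^esub> q) = \<Phi> p * \<Phi> q"
    and one: "\<Phi> (frag_of (1, 1)) = 1\<^sub>m d"
    and of: "\<And>x a. \<Phi> (frag_of (x, a)) = a \<cdot>\<^sub>m \<rho> x"
    and ker: "\<And>p. \<Phi> p = 0\<^sub>m d d \<longleftrightarrow> p \<in> tensor_kernel \<iota> j"
    using representation_as_lift by metis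
  have eq: "\<Phi> p = \<Phi> q" if "p - q \<in> tensor_relators \<iota> j" for p q
  proof -
    have "\<Phi> (p - q) = 0\<^sub>m d d"
      using that by (simp add: ker tensor_kernel_def generate.incl)
    then show ?thesis using add[of "p - q" q] carrier[of q] by simp
  qed
  have \<rho>: "\<rho> x = \<Phi> (frag_of (x, 1))" for x by (simp add: of one_smult_mat)
  show "\<rho> x \<in> carrier_mat d d" for x by (simp only: \<rho> carrier)
  show "\<rho> (x * y) = \<rho> x * \<rho> y"
    using mult[of "frag_of (x, 1)" "frag_of (y, 1)"] by (simp add: \<rho>[symmetric] mult_free_ring_of)
  have "\<Phi> (frag_of (x + y, 1)) = \<Phi> (frag_of (x, 1) + frag_of (y, 1))"
  proof (rule eq)
    have "frag_of (x + y, 1) - frag_of (x, 1) - frag_of (y, 1) \<in> tensor_relators \<iota> j"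
      unfolding tensor_relators_def by blast
    then show "frag_of (x + y, 1) - (frag_of (x, 1) + frag_of (y, 1)) \<in> tensor_relators \<iota> j"
      by (simp add: diff_diff_eq)
  qed
  then show "\<rho> (x + y) = \<rho> x + \<rho> y" by (simp add: add \<rho>[symmetric])
  have "frag_of (1 * \<iota> c, 1) - frag_of (1, j c * 1) \<in> tensor_relators \<iota> j"
    unfolding tensor_relators_def by blast
  from eq[OF this] show "\<rho> (\<iota> c) = j c \<cdot>\<^sub>m 1\<^sub>m d"
    using one by (simp add: of one_smult_mat)
qed

lemma dim_\<rho> [simp]: "dim_row (\<rho> x) = d" "dim_col (\<rho> x) = d"
  using carrier_matD[OF \<rho>_carrier[of x]] by simp_all

lemma \<rho>_one: "\<rho> 1 = 1\<^sub>m d"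
  using \<rho>_scalar[of 1] by (simp add: one_smult_mat)

lemma \<rho>_combination:
  fixes n :: nat
  assumes "r < d" "s < d"
  shows "\<rho> (\<Sum>i<n. \<iota> (c i) * y i) $$ (r, s) = (\<Sum>i<n. j (c i) * \<rho> (y i) $$ (r, s))"
proof (induction n)
  case 0
  have "\<rho> 0 = 0 \<cdot>\<^sub>m 1\<^sub>m d" using \<rho>_scalar[of 0] by simp
  then show ?case using assms by simp
next
  case (Suc n)
  have "\<rho> (\<iota> (c n) * y n) = j (c n) \<cdot>\<^sub>m \<rho> (y n)"
    using mult_smult_assoc_mat[OF one_carrier_mat \<rho>_carrier, of "j (c n)" "y n"]
      left_mult_one_mat[OF \<rho>_carrier]
    by (simp add: \<rho>_mult \<rho>_scalar)
  then show ?case using assms Suc \<rho>_carrier[of "y n"] \<rho>_carrier[of "\<iota> (c n) * y n"]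
    by (simp add: \<rho>_add)
qed

text \<open>
  By injectivity of \<open>D \<otimes>\<^sub>F K \<rightarrow> M\<^sub>d(K)\<close>, a relation between the matrices is one between tensors.
  It is stated entrywise to avoid sums of matrices.
\<close>

lemma independent_over_extension:
  assumes "finite I" "inj_on y I" "D.independent (y ` I)"
    and "\<And>r s. r < d \<Longrightarrow> s < d \<Longrightarrow> (\<Sum>i\<in>I. k i * \<rho> (y i) $$ (r, s)) = 0" and "i \<in> I"
  shows "k i = 0"
proof -
  obtain \<Phi> where carrier: "\<And>p. \<Phi> p \<in> carrier_mat d d"
    and add: "\<And>p q. \<Phi> (p + q) = \<Phi> p + \<Phi> q"
    and of: "\<And>x a. \<Phi> (frag_of (x, a)) = a \<cdot>\<^sub>m \<rho> x"
    and ker: "\<And>p. \<Phi> p = 0\<^sub>m d d \<longleftrightarrow> p \<in> tensor_kernel \<iota> j"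
    using representation_as_lift by metis
  have zero: "\<Phi> 0 = 0\<^sub>m d d" unfolding ker
    using additive_subgroup.zero_closed[OF ker.is_additive_subgroup]
    by (simp add: free_ring_simps)
  have lift_sum: "\<Phi> (\<Sum>i\<in>J. frag_of (y i, k i)) $$ (r, s) = (\<Sum>i\<in>J. k i * \<rho> (y i) $$ (r, s))"
    if "finite J" "r < d" "s < d" for J r s
    using that(1)
  proof (induction J rule: finite_induct)
    case (insert i J)
    then show ?case using that(2,3) carrier[of "\<Sum>i\<in>J. frag_of (y i, k i)"] \<rho>_carrier[of "y i"]
      by (simp add: add of)
  qed (use that zero in simp)
  have "\<Phi> (\<Sum>i\<in>I. frag_of (y i, k i)) = 0\<^sub>m d d"
    using lift_sum[OF assms(1)] assms(4) carrier[of "\<Sum>i\<in>I. frag_of (y i, k i)"] by (intro eq_matI) auto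
  then have "(\<Sum>i\<in>I. frag_of (y i, k i)) \<in> tensor_kernel \<iota> j" by (simp add: ker)
  then show ?thesis by (rule sum_tensor_in_kernel_imp_zero[OF assms(1-3) _ assms(5)])
qed

end

section \<open>Matrices supported on a cycle and a fixed point\<close>

lemma mult_mat_single_row:
  assumes "A \<in> carrier_mat d d" "B \<in> carrier_mat d d" "i < d" "l < d" "k < d"
    and "\<And>l'. l' < d \<Longrightarrow> l' \<noteq> l \<Longrightarrow> A $$ (i, l') = 0"
  shows "(A * B) $$ (i, k) = A $$ (i, l) * (B $$ (l, k) :: 'a::semiring_0)"
proof -
  have "(A * B) $$ (i, k) = (\<Sum>l'<d. A $$ (i, l') * B $$ (l', k))"
    using assms(1-5) by (auto simp: scalar_prod_def lessThan_atLeast0)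
  also have "\<dots> = (\<Sum>l'<d. if l' = l then A $$ (i, l) * B $$ (l, k) else 0)"
    by (rule sum.cong) (use assms(6) in auto)
  also have "\<dots> = A $$ (i, l) * B $$ (l, k)" using assms(4) by simp
  finally show ?thesis .
qed

text \<open>
  Indices start at \<open>0\<close>: the cycle runs through \<open>0, \<dots>, d - 2\<close>.
\<close>

definition cycle_fixing_last :: "nat \<Rightarrow> nat \<Rightarrow> nat" where
  "cycle_fixing_last d i = (if i = d - 1 then i else if i = d - 2 then 0 else Suc i)"

text \<open>
  The nonzero entries are those of the permutation matrix of the cycle; these matrices form its
  coset modulo diagonal matrices.
\<close>

definition cycle_shaped :: "nat \<Rightarrow> 'k::zero mat \<Rightarrow> bool" where
  "cycle_shaped d P \<longleftrightarrow> P \<in> carrier_mat d d \<and>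
     (\<forall>i<d. \<forall>k<d. P $$ (i, k) \<noteq> 0 \<longleftrightarrow> k = cycle_fixing_last d i)"

context split_algebra
begin

text \<open>
  Two row vectors generate the whole space under \<open>P = \<rho> x\<close>: the first, whose images under the powers of
  \<open>P\<close> are multiples of the successive standard vectors of the cycle, and the last, an eigenvector.
  So the relation satisfied by \<open>P\<close> and the independence of its powers are read off from these rows.
  Below, \<open>e = d - 1\<close> is the length of the cycle.
\<close>

lemma not_cycle_shaped:
  assumes "2 < d"
  shows "\<not> cycle_shaped d (\<rho> x)"
proof
  define e where "e = d - 1"
  have e: "d = Suc e" "1 < e" "\<And>y. \<rho> y \<in> carrier_mat (Suc e) (Suc e)"
    using assms \<rho>_carrier by (simp_all add: e_def)
  assume shape: "cycle_shaped d (\<rho> x)"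
  have nz: "\<rho> x $$ (i, k) \<noteq> 0 \<longleftrightarrow> k = cycle_fixing_last d i" if "i < d" "k < d" for i k
    using shape that by (simp add: cycle_shaped_def)
  define b where "b = \<rho> x $$ (e, e)"
  define a where "a = \<rho> (x ^ e) $$ (0, 0)"
  have last_row: "\<rho> x $$ (e, k) = (if k = e then b else 0)" if "k < d" for k
    using nz[of e k] that e by (auto simp: b_def cycle_fixing_last_def)
  have cyc: "cycle_fixing_last d m = (if Suc m = e then 0 else Suc m)" if "m < e" for m
    using that e by (auto simp: cycle_fixing_last_def)
  have pow_Suc_row: "\<rho> (x ^ Suc m) $$ (0, k) = \<rho> (x ^ m) $$ (0, m) * \<rho> x $$ (m, k)"
    if "\<And>k. k < d \<Longrightarrow> \<rho> (x ^ m) $$ (0, k) \<noteq> 0 \<longleftrightarrow> k = m" "m < e" "k < d" for m k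
    using that e unfolding power_Suc2 \<rho>_mult
    by (intro mult_mat_single_row) auto
  have first_row: "\<rho> (x ^ m) $$ (0, k) \<noteq> 0 \<longleftrightarrow> k = m" if "m < e" "k < d" for m k
    using that
  proof (induction m arbitrary: k)
    case 0
    then show ?case using e by (auto simp: \<rho>_one)
  next
    case (Suc m)
    then have "\<rho> (x ^ m) $$ (0, m) \<noteq> 0" using e by simp
    then show ?case
      using pow_Suc_row[of m k] Suc nz[of m k] cyc[of m] e by simp
  qed
  have first_row_e: "\<rho> (x ^ e) $$ (0, k) = (if k = 0 then a else 0)" if "k < d" for k
  proof -
    obtain m where m: "e = Suc m" "m < e" using e(2) by (cases e) auto
    have "\<rho> (x ^ e) $$ (0, k) = \<rho> (x ^ m) $$ (0, m) * \<rho> x $$ (m, k)"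
      unfolding m(1) using pow_Suc_row[of m k] first_row m that by simp
    then show ?thesis using nz[of m k] that m e cyc[of m] by (auto simp: a_def)
  qed
  \<comment> \<open>As \<open>P\<^sup>e\<close> commutes with \<open>P\<^sup>m\<close>, its row \<open>m\<close> is determined by its row \<open>0\<close>.\<close>
  have row_e: "\<rho> (x ^ e) $$ (m, k) = (if k = m then a else 0)" if "m < e" "k < d" for m k
  proof -
    have "(\<rho> (x ^ m) * \<rho> (x ^ e)) $$ (0, k) = \<rho> (x ^ m) $$ (0, m) * \<rho> (x ^ e) $$ (m, k)"
      using first_row that e by (intro mult_mat_single_row) auto
    moreover have "(\<rho> (x ^ e) * \<rho> (x ^ m)) $$ (0, k) = a * \<rho> (x ^ m) $$ (0, k)"
      using first_row_e that e
        mult_mat_single_row[of "\<rho> (x ^ e)" d "\<rho> (x ^ m)" 0 0 k] by simp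
    moreover have "\<rho> (x ^ m) * \<rho> (x ^ e) = \<rho> (x ^ e) * \<rho> (x ^ m)"
      by (metis \<rho>_mult add.commute power_add)
    ultimately have "\<rho> (x ^ m) $$ (0, m) * \<rho> (x ^ e) $$ (m, k) = a * \<rho> (x ^ m) $$ (0, k)"
      by simp
    then show ?thesis using first_row[of m k] first_row[of m m] that e by auto
  qed
  \<comment> \<open>This is \<open>(P - b) (P\<^sup>e - a) = 0\<close>, read off rowwise: the factors commute, so either may come first.\<close>
  have relation: "\<rho> (x ^ d) $$ (r, s)
      = b * \<rho> (x ^ e) $$ (r, s) + a * \<rho> x $$ (r, s) - a * b * \<rho> 1 $$ (r, s)"
    if "r < d" "s < d" for r s
  proof (cases "r = e")
    case True
    have "(\<rho> x * \<rho> (x ^ e)) $$ (e, s) = b * \<rho> (x ^ e) $$ (e, s)"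
      using last_row that e mult_mat_single_row[of "\<rho> x" d "\<rho> (x ^ e)" e e s] by simp
    then show ?thesis
      using True last_row[of s] that unfolding e(1) power_Suc \<rho>_mult \<rho>_one by simp
  next
    case False
    then have r: "r < e" using that e by simp
    have "(\<rho> (x ^ e) * \<rho> x) $$ (r, s) = a * \<rho> x $$ (r, s)"
      using row_e r that e mult_mat_single_row[of "\<rho> (x ^ e)" d "\<rho> x" r r s] by simp
    then show ?thesis
      using row_e[OF r, of s] that unfolding e(1) power_Suc2 \<rho>_mult \<rho>_one by auto
  qed
  \<comment> \<open>The coefficients of \<open>(t - b) (t\<^sup>e - a) = t\<^sup>d - b t\<^sup>e - a t + a b\<close>, as a sum so that each term picks one power.\<close>
  define k where "k i = (if i = d then 1 else 0) - (if i = e then b else 0)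
    - (if i = 1 then a else 0) + (if i = 0 then a * b else 0)" for i
  have k_relation: "(\<Sum>i<Suc d. k i * \<rho> (x ^ i) $$ (r, s)) = 0" if "r < d" "s < d" for r s
  proof -
    let ?f = "\<lambda>i. \<rho> (x ^ i) $$ (r, s)"
    have "(\<Sum>i<Suc d. k i * ?f i) = (\<Sum>i<Suc d. (if i = d then ?f i else 0)
      - (if i = e then b * ?f i else 0) - (if i = 1 then a * ?f i else 0)
      + (if i = 0 then a * b * ?f i else 0))"
      by (rule sum.cong) (auto simp: k_def algebra_simps)
    also have "\<dots> = ?f d - b * ?f e - a * ?f 1 + a * b * ?f 0"
      using e by (simp add: sum.distrib sum_subtractf del: sum.lessThan_Suc)
    also have "\<dots> = 0" using relation[OF that] by simp
    finally show ?thesis .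
  qed
  have "\<not> power_independent x (Suc d)"
  proof
    assume "power_independent x (Suc d)"
    then have "k d = 0"
      unfolding power_independent_def
      by (intro independent_over_extension[of "{..<Suc d}" "(^) x" k]) (simp_all only: k_relation, auto)
    then show False using e by (simp add: k_def)
  qed
  moreover have "\<not> power_independent x d"
  proof
    assume indep: "power_independent x d"
    with calculation have "x ^ d \<in> D.span ((^) x ` {..<d})" by (simp add: power_independent_Suc)
    then obtain c where c: "x ^ d = (\<Sum>i<d. \<iota> (c i) * x ^ i)" using span_lessThan_sum by blast
    have "(\<Sum>i<d. (k i + j (c i)) * \<rho> (x ^ i) $$ (r, s)) = 0" if "r < d" "s < d" for r s
    proof -
      have "k d = 1" using e by (simp add: k_def)
      then show ?thesis
        using k_relation[OF that] \<rho>_combination[OF that, of c "(^) x" d]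
        by (simp add: distrib_right sum.distrib c[symmetric])
    qed
    \<comment> \<open>Comparing the two expressions of \<open>P\<^sup>d\<close> at \<open>P\<^sup>e\<close>; here \<open>e \<noteq> 1\<close> keeps \<open>a\<close> out of the coefficient.\<close>
    then have "k e + j (c e) = 0"
      using indep e unfolding power_independent_def
      by (intro independent_over_extension[of "{..<d}" "(^) x" "\<lambda>i. k i + j (c i)" e]) auto
    then have b: "b = j (c e)" using e by (simp add: k_def)
    define y where "y = x - \<iota> (c e)"
    have \<rho>x: "\<rho> x = \<rho> y + b \<cdot>\<^sub>m 1\<^sub>m d"
      using \<rho>_add[of y "\<iota> (c e)"] by (simp add: y_def \<rho>_scalar b)
    have y_row: "\<rho> y $$ (e, l) = 0" if "l < d" for l
    proof -
      have "\<rho> x $$ (e, l) = \<rho> y $$ (e, l) + b * (if e = l then 1 else 0)"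
        unfolding \<rho>x using that e by simp
      then show ?thesis using last_row[OF that] by (simp split: if_splits)
    qed
    \<comment> \<open>A nonzero element of a division ring has an invertible matrix, which has no zero row.\<close>
    have "y = 0"
    proof (rule ccontr)
      assume "y \<noteq> 0"
      then have "\<rho> y * \<rho> (inverse y) = 1\<^sub>m d" by (simp add: \<rho>_one flip: \<rho>_mult)
      moreover have "(\<rho> y * \<rho> (inverse y)) $$ (e, e) = 0"
        using y_row e mult_mat_single_row[of "\<rho> y" d "\<rho> (inverse y)" e e e] by simp
      ultimately show False using e by simp
    qed
    then have "\<rho> x = b \<cdot>\<^sub>m 1\<^sub>m d" using \<rho>_scalar[of "c e"] by (simp add: y_def b)
    then have "\<rho> x $$ (0, 1) = 0" using e by simp
    then show False using nz[of 0 1] cyc[of 0] e by simp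
  qed
  moreover have "power_independent x m" if "m \<le> e" for m
    using that
  proof (induction m)
    case 0
    then show ?case by (simp add: power_independent_def D.independent_empty)
  next
    case (Suc m)
    have "x ^ m \<notin> D.span ((^) x ` {..<m})"
    proof
      assume "x ^ m \<in> D.span ((^) x ` {..<m})"
      then obtain c where c: "x ^ m = (\<Sum>i<m. \<iota> (c i) * x ^ i)" using span_lessThan_sum by blast
      \<comment> \<open>In row \<open>0\<close>, no power of \<open>P\<close> below \<open>m\<close> has an entry in column \<open>m\<close>.\<close>
      have "\<rho> (x ^ m) $$ (0, m) = (\<Sum>i<m. j (c i) * \<rho> (x ^ i) $$ (0, m))"
        using \<rho>_combination[of 0 m c "(^) x" m] c Suc e by simp
      also have "\<dots> = 0"
      proof (intro sum.neutral ballI)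
        fix i assume "i \<in> {..<m}"
        then show "j (c i) * \<rho> (x ^ i) $$ (0, m) = 0" using first_row[of i m] Suc e by simp
      qed
      finally show False using first_row[of m m] Suc e by simp
    qed
    then show ?case using Suc by (simp add: power_independent_Suc)
  qed
  ultimately have "e dvd d\<^sup>2"
    using e monogenic_degree_dvd[of e x] power_independent_Suc[of x e]
    by (auto simp: power_independent_def)
  moreover have "d\<^sup>2 = e * (e + 2) + 1" using e by (simp add: power2_eq_square)
  ultimately have "e dvd 1" by (metis dvd_add_right_iff dvd_triv_left)
  then show False using e by simp
qed

end

section \<open>Conjugation and the coset of the cycle\<close>

text \<open>
  Conjugation is an automorphism of the matrix algebra. This is why the conjugating matrix in the
  theorem can be absorbed into the representation.
\<close>

lemma splitting_representation_conjugate: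
  fixes g h :: "'k::field mat"
  assumes "splitting_representation \<iota> j d \<rho>"
    and carrier: "g \<in> carrier_mat d d" "h \<in> carrier_mat d d"
    and gh: "g * h = 1\<^sub>m d" "h * g = 1\<^sub>m d"
  shows "splitting_representation \<iota> j d (\<lambda>x. g * \<rho> x * h)"
proof -
  let ?M = "mat_algebra d :: ('k, 'k mat) module" and ?c = "\<lambda>A. g * A * h"
  from assms(1) obtain \<phi> where \<phi>: "\<phi> \<in> algebra_iso (tensor_algebra \<iota> j) ?M"
    and \<rho>: "\<And>x. \<rho> x = \<phi> (pure_tensor \<iota> j x 1)"
    unfolding splitting_representation_def by blast
  have closed: "?c A \<in> carrier_mat d d" if "A \<in> carrier_mat d d" for A
    using that carrier by simp
  have cancel: "h * (g * A * h) * g = A" "g * (h * A * g) * h = A" "h * (g * A) = A"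
    if A: "A \<in> carrier_mat d d" for A
  proof -
    note assoc = assoc_mult_mat[of _ d d _ d _ d]
    show 1: "h * (g * A) = A" using assoc[of h g A] A carrier gh by simp
    have 2: "g * (h * A) = A" using assoc[of g h A] A carrier gh by simp
    have 3: "A * h * g = A" using assoc[of A h g] A carrier gh by simp
    have 4: "A * g * h = A" using assoc[of A g h] A carrier gh by simp
    show "h * (g * A * h) * g = A"
      using assoc[of h "g * A" h] A carrier 1 3 by simp
    show "g * (h * A * g) * h = A"
      using assoc[of g "h * A" g] A carrier 2 4 by simp
  qed
  have mult: "?c (A * B) = ?c A * ?c B" if A: "A \<in> carrier_mat d d" and B: "B \<in> carrier_mat d d" for A B
  proof -
    note assoc = assoc_mult_mat[of _ d d _ d _ d]
    have "?c A * ?c B = g * A * (h * (g * B * h))"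
      using assoc[of "g * A" h "g * B * h"] A B carrier by simp
    also have "h * (g * B * h) = B * h"
      using assoc[of h "g * B" h] cancel(3)[OF B] B carrier by simp
    also have "g * A * (B * h) = ?c (A * B)"
      using assoc[of "g * A" B h] assoc[of g A B] A B carrier by simp
    finally show ?thesis ..
  qed
  have "?c \<in> ring_iso ?M ?M"
  proof (rule ring_iso_memI)
    have "h * A * g \<in> carrier_mat d d" if "A \<in> carrier_mat d d" for A
      using that carrier by simp
    then show "bij_betw ?c (carrier ?M) (carrier ?M)"
      unfolding module_mat_simps using closed cancel(1,2)
      by (intro bij_betw_byWitness[where f' = "\<lambda>A. h * A * g"] ballI image_subsetI)
    show "?c A \<in> carrier ?M" if "A \<in> carrier ?M" for A
      using that closed unfolding module_mat_simps by blast
    show "?c (A \<otimes>\<^bsub>?M\<^esub> B) = ?c A \<otimes>\<^bsub>?M\<^esub> ?c B" if "A \<in> carrier ?M" "B \<in> carrier ?M" for A B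
      using that mult unfolding module_mat_simps by blast
    show "?c \<one>\<^bsub>?M\<^esub> = \<one>\<^bsub>?M\<^esub>"
      unfolding module_mat_simps using carrier gh by simp
    show "?c (A \<oplus>\<^bsub>?M\<^esub> B) = ?c A \<oplus>\<^bsub>?M\<^esub> ?c B" if "A \<in> carrier ?M" "B \<in> carrier ?M" for A B
      using that carrier mult_add_distrib_mat[of g d d A d B]
        add_mult_distrib_mat[of "g * A" d d "g * B" h d]
      by (simp add: module_mat_simps)
  qed
  moreover have "\<phi> \<in> ring_iso (tensor_algebra \<iota> j) ?M" using \<phi> by (simp add: algebra_iso_def)
  ultimately have "?c \<circ> \<phi> \<in> ring_iso (tensor_algebra \<iota> j) ?M"
    using ring_iso_set_trans by blast
  moreover have "(?c \<circ> \<phi>) (a \<odot>\<^bsub>tensor_algebra \<iota> j\<^esub> x) = a \<odot>\<^bsub>?M\<^esub> (?c \<circ> \<phi>) x"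
    if x: "x \<in> carrier (tensor_algebra \<iota> j)" for a x
  proof -
    have "\<phi> x \<in> carrier_mat d d"
      using \<phi> x by (auto simp: algebra_iso_def ring_iso_def ring_hom_def module_mat_simps)
    moreover have "\<phi> (a \<odot>\<^bsub>tensor_algebra \<iota> j\<^esub> x) = a \<cdot>\<^sub>m \<phi> x"
      using \<phi> x by (simp add: algebra_iso_def module_mat_simps)
    ultimately show ?thesis
      using carrier mult_smult_distrib[of g d d "\<phi> x" d a]
        mult_smult_assoc_mat[of "g * \<phi> x" d d h d a]
      by (simp add: module_mat_simps)
  qed
  ultimately have "?c \<circ> \<phi> \<in> algebra_iso (tensor_algebra \<iota> j) ?M"
    by (simp add: algebra_iso_def)
  then show ?thesis unfolding splitting_representation_def \<rho> by (intro bexI[of _ "?c \<circ> \<phi>"]) simp_all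
qed

lemma GL_simps:
  "carrier (GL d) = {A \<in> carrier_mat d d. \<exists>B\<in>carrier_mat d d. B * A = 1\<^sub>m d \<and> A * B = 1\<^sub>m d}"
  "mult (GL d) = (*)" "one (GL d) = 1\<^sub>m d"
  by (auto simp: GL_def units_of_def Units_def module_mat_simps)

lemma group_GL: "group (GL d :: 'k::field mat monoid)"
proof -
  interpret ring "mat_algebra d :: ('k, 'k mat) module"
    using ring_mat[where 'a='k and n=d] by (simp add: module_mat_def ring_mat_def)
  show ?thesis unfolding GL_def by (rule units_group)
qed

definition cycle_mat :: "nat \<Rightarrow> 'k::zero_neq_one mat" where
  "cycle_mat d = mat d d (\<lambda>(i, k). if k = cycle_fixing_last d i then 1 else 0)"

lemma cycle_fixing_last_bij:
  assumes "2 < d"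
  shows "bij_betw (cycle_fixing_last d) {..<d} {..<d}"
proof (rule bij_betw_byWitness[where f' = "\<lambda>k. if k = d - 1 then k else if k = 0 then d - 2 else k - 1"])
qed (use assms in \<open>auto simp: cycle_fixing_last_def split: if_splits\<close>)

lemma cycle_mat_mult_transpose:
  assumes "2 < d"
  shows "cycle_mat d * transpose_mat (cycle_mat d) = (1\<^sub>m d :: 'k::field mat)"
proof (rule eq_matI)
  let ?w = "cycle_mat d :: 'k mat" and ?\<sigma> = "cycle_fixing_last d"
  have w: "?w \<in> carrier_mat d d" by (simp add: cycle_mat_def)
  have bij: "bij_betw ?\<sigma> {..<d} {..<d}" using assms by (rule cycle_fixing_last_bij)
  fix i k assume "i < dim_row (1\<^sub>m d :: 'k mat)" "k < dim_col (1\<^sub>m d :: 'k mat)"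
  then have ik: "i < d" "k < d" by simp_all
  have \<sigma>: "?\<sigma> i < d" using bij_betwE[OF bij] ik by simp
  have "(?w * transpose_mat ?w) $$ (i, k) = ?w $$ (i, ?\<sigma> i) * transpose_mat ?w $$ (?\<sigma> i, k)"
    using w ik \<sigma> by (intro mult_mat_single_row[of _ d]) (auto simp: cycle_mat_def)
  also have "\<dots> = (if ?\<sigma> i = ?\<sigma> k then 1 else 0)" using ik \<sigma> by (simp add: cycle_mat_def)
  also have "\<dots> = 1\<^sub>m d $$ (i, k)"
    using ik inj_on_eq_iff[OF bij_betw_imp_inj_on[OF bij], of i k] by simp
  finally show "(?w * transpose_mat ?w) $$ (i, k) = 1\<^sub>m d $$ (i, k)" .
qed (simp_all add: cycle_mat_def)

lemma cycle_mat_monomial: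
  assumes "2 < d"
  shows "(cycle_mat d :: 'k::field mat) \<in> monomial_subgroup d"
proof -
  let ?w = "cycle_mat d :: 'k mat" and ?\<sigma> = "cycle_fixing_last d"
  have w: "?w \<in> carrier_mat d d" "transpose_mat ?w \<in> carrier_mat d d" by (simp_all add: cycle_mat_def)
  have bij: "bij_betw ?\<sigma> {..<d} {..<d}" using assms by (rule cycle_fixing_last_bij)
  have inv: "?w * transpose_mat ?w = 1\<^sub>m d" using assms by (rule cycle_mat_mult_transpose)
  then have "?w \<in> carrier (GL d)"
    using w mat_mult_left_right_inverse[OF w inv] by (auto simp: GL_simps)
  moreover have "\<exists>!k. k < d \<and> ?w $$ (i, k) \<noteq> 0" if "i < d" for i
    using that bij_betwE[OF bij] by (intro ex1I[of _ "?\<sigma> i"]) (auto simp: cycle_mat_def split: if_splits)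
  moreover have "\<exists>!i. i < d \<and> ?w $$ (i, k) \<noteq> 0" if k: "k < d" for k
  proof -
    obtain i where i: "i < d" "k = ?\<sigma> i"
      using bij_betw_imp_surj_on[OF bij] k by auto
    show ?thesis
    proof (rule ex1I[of _ i])
      show "i < d \<and> ?w $$ (i, k) \<noteq> 0" using i k by (simp add: cycle_mat_def)
      fix i' assume "i' < d \<and> ?w $$ (i', k) \<noteq> 0"
      then show "i' = i"
        using i k inj_on_eq_iff[OF bij_betw_imp_inj_on[OF bij], of i' i]
        by (auto simp: cycle_mat_def split: if_splits)
    qed
  qed
  ultimately show ?thesis using w by (simp add: monomial_subgroup_def monomial_mat_def)
qed

text \<open>
  Left multiplication by a diagonal matrix rescales rows, and the diagonal entries of an invertible
  diagonal matrix do not vanish.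
\<close>

lemma diagonal_times_cycle_mat:
  fixes t :: "'k::field mat"
  assumes "t \<in> diagonal_subgroup d"
  shows "cycle_shaped d (t * cycle_mat d)"
proof -
  have t: "t \<in> carrier_mat d d" and diag: "\<And>i k. i < d \<Longrightarrow> k < d \<Longrightarrow> i \<noteq> k \<Longrightarrow> t $$ (i, k) = 0"
    using assms by (auto simp: diagonal_subgroup_def GL_simps diagonal_mat_def)
  obtain s where s: "s \<in> carrier_mat d d" "t * s = 1\<^sub>m d"
    using assms by (auto simp: diagonal_subgroup_def GL_simps)
  have w: "(cycle_mat d :: 'k mat) \<in> carrier_mat d d" by (simp add: cycle_mat_def)
  have row: "(t * A) $$ (i, k) = t $$ (i, i) * A $$ (i, k)"
    if "A \<in> carrier_mat d d" "i < d" "k < d" for A i k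
    using t diag that by (intro mult_mat_single_row[of _ d]) auto
  have "t $$ (i, i) \<noteq> 0" if "i < d" for i
    using row[OF s(1) that that] s(2) that by auto
  then show ?thesis
    using t w row[OF w] by (simp add: cycle_shaped_def) (simp add: cycle_mat_def)
qed

theorem theorem3p3:
  fixes \<iota> :: "'f::field \<Rightarrow> 'd::division_ring"
    and j :: "'f \<Rightarrow> 'k::field"
    and \<rho> :: "'d \<Rightarrow> 'k mat"
    and d :: nat
  assumes "central_division_algebra \<iota> d"
    and "d > 2"
    and "splitting_field \<iota> j d"
    and "splitting_representation \<iota> j d \<rho>"
  shows "\<exists>X \<in> carrier (GL d\<lparr>carrier := monomial_subgroup d\<rparr> Mod diagonal_subgroup d).
           \<forall>g \<in> carrier (GL d).
             (g <#\<^bsub>GL d\<^esub> (\<rho> ` {x. x \<noteq> 0}) #>\<^bsub>GL d\<^esub> inv\<^bsub>GL d\<^esub> g) \<inter> X = {}"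
proof -
  interpret GL: group "GL d :: 'k mat monoid" by (rule group_GL)
  define X where
    "X = diagonal_subgroup d #>\<^bsub>GL d\<lparr>carrier := monomial_subgroup d\<rparr>\<^esub> (cycle_mat d :: 'k mat)"
  have "X \<in> carrier (GL d\<lparr>carrier := monomial_subgroup d\<rparr> Mod diagonal_subgroup d)"
    using cycle_mat_monomial[OF assms(2)] unfolding X_def FactGroup_def RCOSETS_def by auto
  moreover have "P \<notin> X"
    if g: "g \<in> carrier (GL d)"
      and P: "P \<in> g <#\<^bsub>GL d\<^esub> (\<rho> ` {x. x \<noteq> 0}) #>\<^bsub>GL d\<^esub> inv\<^bsub>GL d\<^esub> g" for g P
  proof
    assume "P \<in> X"
    then have shaped: "cycle_shaped d P"
      using diagonal_times_cycle_mat by (auto simp: X_def r_coset_def GL_simps)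
    let ?h = "inv\<^bsub>GL d\<^esub> g"
    obtain x where x: "P = g * \<rho> x * ?h"
      using P by (auto simp: r_coset_def l_coset_def GL_simps)
    have "splitting_representation \<iota> j d (\<lambda>x. g * \<rho> x * ?h)"
    proof (rule splitting_representation_conjugate[OF assms(4)])
      show "g \<in> carrier_mat d d" "?h \<in> carrier_mat d d"
        using g GL.inv_closed[OF g] by (simp_all add: GL_simps)
      show "g * ?h = 1\<^sub>m d" "?h * g = 1\<^sub>m d"
        using GL.r_inv[OF g] GL.l_inv[OF g] by (simp_all add: GL_simps)
    qed
    then interpret split_algebra \<iota> d j "\<lambda>x. g * \<rho> x * ?h"
      using assms(1,3)
      by (intro split_algebra.intro central_division.intro split_algebra_axioms.intro)
        (simp_all add: splitting_field_def)
    show False using not_cycle_shaped[OF assms(2), of x] shaped x by simp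
  qed
  ultimately show ?thesis by blast
qed

end
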